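(* Let $N\ge1$ be an integer, let $B,R>0$, let $X\subseteq\mathbb{R}^n$ be a nonempty closed convex set, and let $f$ be a convex function whose domain contains $X$, with $\partial f(x)\ne\emptyset$ for every $x\in X$ and with $B$-bounded subgradients on $X$. Let $x^*$ be a minimizer of $f$ over $X$ and let $x^1\in X$ satisfy $\|x^1-x^*\|\le R$. Let $t>0$ and let $x^2,\dots,x^{N+1}$ be generated by $$x^{k+1}=P_X\left(x^k-t\tfrac{R}{\|g^k\|}g^k\right),\qquad g^k\in\partial f(x^k),\quad g^k\neq0,\qquad k=1,\dots,N.$$ Then: (i) if $t\in\left(0,\frac{1}{s_{N+1}^2}\right]$, then $f(x^{N+1})-f(x^* )\le BR\,(1-Nt)$; (ii) if $t\in\left[\frac{1}{s_{N+1}^2},\infty\right)$, then $f(x^{N+1})-f(x^* )\le BR\left(\left(\tfrac12 s_{N+1}^2-N\right)t+\frac{1}{2s_{N+1}^2t}\right)$.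
   Context: $\|\cdot\|$ is the Euclidean norm and $P_X$ is the Euclidean projection onto $X$. The subdifferential is $\partial f(x)=\{g\in\mathbb{R}^n : f(y)\ge f(x)+\langle g,y-x\rangle \text{ for all } y\in\mathrm{dom} f\}$. The function $f$ has $B$-bounded subgradients on $X$ if $\|g\|\le B$ for all $x\in X$ and $g\in\partial f(x)$. The real sequence $(s_k)_{k\ge1}$ is defined by $s_1=1$ and $s_{k+1}=s_k+\frac{1}{s_k}$. *)

theory Defs
  imports "HOL-Analysis.Analysis"
begin

text \<open>A convex function with values in the reals and plus infinity is represented by its
  effective domain \<open>D\<close> and a real-valued function \<open>f\<close> whose values outside \<open>D\<close> are
  irrelevant; \<open>convex_on D f\<close> includes convexity of \<open>D\<close>.\<close>

text \<open>Only meaningful for \<open>x \<in> D\<close>.\<close>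
definition subdifferential ::
  "(real ^ 'n) set \<Rightarrow> (real ^ 'n \<Rightarrow> real) \<Rightarrow> real ^ 'n \<Rightarrow> (real ^ 'n) set" where
  "subdifferential D f x = {g. \<forall>y\<in>D. f y \<ge> f x + g \<bullet> (y - x)}"

definition bounded_subgradients ::
  "real \<Rightarrow> (real ^ 'n) set \<Rightarrow> (real ^ 'n \<Rightarrow> real) \<Rightarrow> (real ^ 'n) set \<Rightarrow> bool" where
  "bounded_subgradients B D f X \<longleftrightarrow> (\<forall>x\<in>X. \<forall>g\<in>subdifferential D f x. norm g \<le> B)"

text \<open>The sequence starts at index 1; the value at 0 is a dummy.\<close>
fun s_seq :: "nat \<Rightarrow> real" where
  "s_seq 0 = 0"
| "s_seq (Suc 0) = 1"
| "s_seq (Suc (Suc k)) = s_seq (Suc k) + 1 / s_seq (Suc k)"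

end

theory Submission
  imports Defs
begin

text \<open>Write \<open>p = x\<^sup>k\<close> and let \<open>q\<close> be the next iterate. A bound
  \<open>f(x\<^bsup>N+1\<^esup>) - f(w) \<le> B \<bar>q - w\<bar>\<^sup>2 / (2 t R a\<^sup>2) + E\<close>, valid for all \<open>w \<in> X\<close>, is pulled back to one
  of the same shape with \<open>p\<close> in place of \<open>q\<close>: apply it at a point \<open>w\<close> of the segment from \<open>p\<close> to
  the given \<open>z\<close>, chosen so that the multiples of \<open>f(p)\<close> coming from convexity and from the
  subgradient inequality cancel. This replaces \<open>a\<close> by \<open>a + B / (\<bar>g\<bar> a) \<ge> a + 1 / a\<close>. Starting at
  \<open>x\<^bsup>N+1\<^esup>\<close> from an arbitrary \<open>a = \<tau> \<ge> 1\<close> and iterating down to \<open>x\<^sup>1\<close> gives, with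
  \<open>b\<close> the \<open>N\<close>-th iterate of \<open>\<tau>\<close> under \<open>a \<mapsto> a + 1 / a\<close>, the bound
  \<open>B R (1 / (2 t b\<^sup>2) + t b\<^sup>2 / 2 - N t)\<close>. For \<open>\<tau> = 1\<close> one has \<open>b = s\<^bsub>N+1\<^esub>\<close>, which is (ii);
  if \<open>1 / \<surd>t \<ge> s\<^bsub>N+1\<^esub>\<close>, some \<open>\<tau>\<close> gives \<open>b = 1 / \<surd>t\<close>, which is (i).\<close>

definition add_inverse :: "real \<Rightarrow> real" where
  "add_inverse b = b + 1 / b"

lemma add_inverse_ge: "b \<ge> 0 \<Longrightarrow> b \<le> add_inverse b"
  by (simp add: add_inverse_def)

text \<open>The difference \<open>1 / b - 1 / a\<close> equals \<open>(a - b) / (a * b)\<close>,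
  which is at most \<open>a - b\<close> once \<open>a * b \<ge> 1\<close>.\<close>

lemma add_inverse_mono:
  assumes "1 \<le> b" "b \<le> a"
  shows "add_inverse b \<le> add_inverse a"
proof -
  have "1 * 1 \<le> a * b" using assms by (intro mult_mono) auto
  then have "(a - b) / (a * b) \<le> (a - b) / 1" using assms by (intro divide_left_mono) auto
  moreover have "1 / b - 1 / a = (a - b) / (a * b)" using assms by (simp add: field_simps)
  ultimately show ?thesis unfolding add_inverse_def by simp
qed

lemma add_inverse_power2: "b \<noteq> 0 \<Longrightarrow> (add_inverse b)\<^sup>2 = b\<^sup>2 + 2 + 1 / b\<^sup>2"
  by (simp add: add_inverse_def power2_eq_square field_simps)

lemma funpow_add_inverse_ge: "\<tau> \<ge> 1 \<Longrightarrow> \<tau> \<le> (add_inverse ^^ n) \<tau>"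
proof (induction n)
  case (Suc n)
  then show ?case using add_inverse_ge[of "(add_inverse ^^ n) \<tau>"] by simp
qed simp

lemma s_seq_eq_funpow: "s_seq (Suc n) = (add_inverse ^^ n) 1"
  by (induction n) (auto simp: add_inverse_def)

lemma continuous_on_funpow_add_inverse: "continuous_on {1..} (add_inverse ^^ n)"
proof (induction n)
  case 0
  then show ?case by (simp add: id_def)
next
  case (Suc n)
  have "(add_inverse ^^ n) \<tau> \<noteq> 0" if "\<tau> \<in> {1..}" for \<tau>
    using funpow_add_inverse_ge[of \<tau> n] that by auto
  then have "continuous_on {1..} (\<lambda>\<tau>. (add_inverse ^^ n) \<tau> + 1 / (add_inverse ^^ n) \<tau>)"
    using Suc by (intro continuous_intros) auto
  then show ?case by (simp add: add_inverse_def[of "(add_inverse ^^ n) _"] o_def)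
qed

text \<open>Intermediate value theorem on \<open>{1..\<beta>}\<close>: the value at \<open>1\<close>
  is \<open>s_seq (Suc n)\<close>, and the value at \<open>\<beta>\<close> is at least
  \<open>\<beta>\<close>.\<close>

lemma funpow_add_inverse_surj:
  assumes "\<beta> \<ge> s_seq (Suc n)"
  obtains \<tau> where "\<tau> \<ge> 1" "(add_inverse ^^ n) \<tau> = \<beta>"
proof -
  have 1: "(add_inverse ^^ n) 1 \<le> \<beta>" using assms by (simp add: s_seq_eq_funpow)
  have "1 \<le> \<beta>" using 1 funpow_add_inverse_ge[of 1 n] by simp
  moreover have "continuous_on {1..\<beta>} (add_inverse ^^ n)"
    by (rule continuous_on_subset[OF continuous_on_funpow_add_inverse]) auto
  ultimately show thesis
    using IVT'[of "add_inverse ^^ n" 1 \<beta> \<beta>] 1 funpow_add_inverse_ge[of \<beta> n] that by auto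
qed

text \<open>The exact \<open>a'\<close> depends on \<open>norm g\<close>, hence the existential. The
  lower bound \<open>b\<close> does not, so stating the error term with \<open>b\<close> lets errors
  from successive steps be summed.\<close>

lemma projected_subgradient_pullback:
  fixes X D :: "(real ^ 'n) set" and p q g :: "real ^ 'n" and f :: "real ^ 'n \<Rightarrow> real"
  assumes X: "closed X" "convex X" "X \<subseteq> D" and f: "convex_on D f"
    and p: "p \<in> X" and g: "g \<in> subdifferential D f p" "g \<noteq> 0" "norm g \<le> B"
    and \<rho>: "\<rho> > 0" and q: "q = closest_point X (p - (\<rho> / norm g) *\<^sub>R g)"
    and b: "1 \<le> b" "b \<le> a"
    and bound: "\<And>w. w \<in> X \<Longrightarrow> F - f w \<le> B / (2 * \<rho> * a\<^sup>2) * (norm (q - w))\<^sup>2 + E"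
  shows "\<exists>a'\<ge>add_inverse b. \<forall>z\<in>X.
           F - f z \<le> B / (2 * \<rho> * a'\<^sup>2) * (norm (p - z))\<^sup>2 + E + B * \<rho> / (2 * b\<^sup>2)"
proof -
  define G where "G = norm g"
  have G: "G > 0" "G \<le> B" using g by (auto simp: G_def)
  have a: "a > 0" using b by simp
  define a' where "a' = a + B / G / a"
  have "1 / a \<le> B / G / a" using G a by (intro divide_right_mono) auto
  then have a'_ge: "add_inverse b \<le> a'"
    using add_inverse_mono[OF b] unfolding a'_def add_inverse_def by linarith
  have a': "a' > a" using G a by (simp add: a'_def)
  \<comment> \<open>The weight of \<open>z\<close> in \<open>w\<close>. It makes
    \<open>r\<^sup>2 / a\<^sup>2 = 1 / a'\<^sup>2\<close> and satisfies \<open>cancel\<close>, whose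
    right side \<open>1 - r\<close> is the weight of \<open>f p\<close> in
    \<open>fw\<close>.\<close>
  define r where "r = a / a'"
  have r: "0 < r" "r < 1" using a a' by (auto simp: r_def)
  have cancel: "B / (\<rho> * a\<^sup>2) * (\<rho> / G) * r = 1 - r"
  proof -
    have "B / (\<rho> * a\<^sup>2) * (\<rho> / G) * r = (B / G / a) / a'"
      using a a' \<rho> by (simp add: r_def power2_eq_square)
    also have "\<dots> = 1 - r" using a a' by (simp add: a'_def r_def field_simps)
    finally show ?thesis .
  qed
  have "F - f z \<le> B / (2 * \<rho> * a'\<^sup>2) * (norm (p - z))\<^sup>2 + E + B * \<rho> / (2 * b\<^sup>2)" if z: "z \<in> X" for z
  proof -
    define w where "w = r *\<^sub>R z + (1 - r) *\<^sub>R p"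
    have w: "w \<in> X" unfolding w_def using X(2) p z r by (intro convexD) auto
    have fw: "f w \<le> r * f z + (1 - r) * f p"
      using convex_onD[OF f, of r p z] X(3) p z r by (auto simp: w_def add.commute)
    have pw: "p - w = r *\<^sub>R (p - z)" by (simp add: w_def algebra_simps)
    have sub: "f p - f z \<le> g \<bullet> (p - z)"
      using g(1) z X(3) by (fastforce simp: subdifferential_def inner_diff_right)
    \<comment> \<open>Projection onto \<open>X\<close> is nonexpansive and fixes
      \<open>w\<close>.\<close>
    have "norm (q - w) \<le> norm (p - w - (\<rho> / G) *\<^sub>R g)"
      using closest_point_lipschitz[of X "p - (\<rho> / G) *\<^sub>R g" w] X w
      by (auto simp: q G_def dist_norm closest_point_self algebra_simps)
    then have "(norm (q - w))\<^sup>2 \<le> (norm (p - w - (\<rho> / G) *\<^sub>R g))\<^sup>2"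
      by (intro power_mono) auto
    also have "\<dots> = (norm (p - w))\<^sup>2 - 2 * (\<rho> / G) * (g \<bullet> (p - w)) + (\<rho> / G)\<^sup>2 * G\<^sup>2"
      unfolding G_def power2_norm_eq_inner
      by (simp add: inner_diff_left inner_diff_right inner_commute power2_eq_square
          diff_divide_distrib algebra_simps)
    also have "\<dots> = r\<^sup>2 * (norm (p - z))\<^sup>2 - 2 * (\<rho> / G) * r * (g \<bullet> (p - z)) + \<rho>\<^sup>2"
      using G r by (simp add: pw power_mult_distrib power_divide)
    also have "\<dots> \<le> r\<^sup>2 * (norm (p - z))\<^sup>2 - 2 * (\<rho> / G) * r * (f p - f z) + \<rho>\<^sup>2"
      using mult_left_mono[OF sub, of "2 * (\<rho> / G) * r"] \<rho> G r by simp
    finally have dist: "(norm (q - w))\<^sup>2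
        \<le> r\<^sup>2 * (norm (p - z))\<^sup>2 - 2 * (\<rho> / G) * r * (f p - f z) + \<rho>\<^sup>2" .
    have "F - f w \<le> B / (2 * \<rho> * a\<^sup>2) * (norm (q - w))\<^sup>2 + E"
      by (rule bound[OF w])
    also have "\<dots> \<le> B / (2 * \<rho> * a\<^sup>2)
        * (r\<^sup>2 * (norm (p - z))\<^sup>2 - 2 * (\<rho> / G) * r * (f p - f z) + \<rho>\<^sup>2) + E"
      using mult_left_mono[OF dist, of "B / (2 * \<rho> * a\<^sup>2)"] \<rho> G by simp
    also have "\<dots> = B / (2 * \<rho> * a'\<^sup>2) * (norm (p - z))\<^sup>2
        - (B / (\<rho> * a\<^sup>2) * (\<rho> / G) * r) * (f p - f z) + B * \<rho> / (2 * a\<^sup>2) + E"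
    proof -
      have "B / (2 * \<rho> * a\<^sup>2) * r\<^sup>2 = B / (2 * \<rho> * a'\<^sup>2)"
        using a a' by (simp add: r_def power_divide)
      moreover have "B / (2 * \<rho> * a\<^sup>2) * \<rho>\<^sup>2 = B * \<rho> / (2 * a\<^sup>2)"
        using \<rho> by (simp add: power2_eq_square)
      moreover have "B / (2 * \<rho> * a\<^sup>2) * (u * P - 2 * e * r * d + v) + E
          = (B / (2 * \<rho> * a\<^sup>2) * u) * P - (B / (\<rho> * a\<^sup>2) * e * r) * d
            + B / (2 * \<rho> * a\<^sup>2) * v + E" for u P e d v
        by (simp add: diff_divide_distrib add_divide_distrib algebra_simps)
      ultimately show ?thesis by (simp only:)
    qed
    finally have "F - f w \<le> B / (2 * \<rho> * a'\<^sup>2) * (norm (p - z))\<^sup>2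
        - (1 - r) * (f p - f z) + B * \<rho> / (2 * a\<^sup>2) + E"
      unfolding cancel .
    moreover have "B * \<rho> / (2 * a\<^sup>2) \<le> B * \<rho> / (2 * b\<^sup>2)"
      using b \<rho> G by (intro divide_left_mono mult_left_mono power_mono) auto
    ultimately show ?thesis using fw by (simp add: algebra_simps)
  qed
  then show ?thesis using a'_ge by blast
qed

text \<open>Induction on the number \<open>j\<close> of steps taken back from the last iterate. The
  errors telescope: \<open>(add_inverse b)\<^sup>2 - b\<^sup>2 - 2 = 1 / b\<^sup>2\<close>.\<close>

lemma projected_subgradient_last_iterate:
  fixes X D :: "(real ^ 'n) set" and f :: "real ^ 'n \<Rightarrow> real" and x g :: "nat \<Rightarrow> real ^ 'n"
  assumes B: "B > 0" and \<rho>: "\<rho> > 0" and X: "closed X" "convex X" "X \<subseteq> D"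
    and f: "convex_on D f" and x: "\<And>k. k \<in> {1..N + 1} \<Longrightarrow> x k \<in> X"
    and subdiff: "subdifferential D f (x (N + 1)) \<noteq> {}"
    and bounded: "bounded_subgradients B D f X"
    and step: "\<And>k. k \<in> {1..N} \<Longrightarrow> g k \<in> subdifferential D f (x k) \<and> g k \<noteq> 0 \<and>
           x (k + 1) = closest_point X (x k - (\<rho> / norm (g k)) *\<^sub>R g k)"
    and \<tau>: "\<tau> \<ge> 1" and "j \<le> N"
  shows "\<exists>a\<ge>(add_inverse ^^ j) \<tau>. \<forall>z\<in>X. f (x (N + 1)) - f z
           \<le> B / (2 * \<rho> * a\<^sup>2) * (norm (x (N + 1 - j) - z))\<^sup>2
             + B * \<rho> / 2 * (((add_inverse ^^ j) \<tau>)\<^sup>2 - 2 * real j)"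
  using \<open>j \<le> N\<close>
proof (induction j)
  case 0
  obtain h where h: "h \<in> subdifferential D f (x (N + 1))" using subdiff by blast
  have hB: "norm h \<le> B" using bounded h x[of "N + 1"] by (auto simp: bounded_subgradients_def)
  have "f (x (N + 1)) - f z \<le> B / (2 * \<rho> * \<tau>\<^sup>2) * (norm (x (N + 1) - z))\<^sup>2 + B * \<rho> / 2 * \<tau>\<^sup>2"
    if z: "z \<in> X" for z
  proof -
    define d where "d = norm (x (N + 1) - z)"
    have "f (x (N + 1)) - f z \<le> h \<bullet> (x (N + 1) - z)"
      using h z X(3) by (fastforce simp: subdifferential_def inner_diff_right)
    also have "\<dots> \<le> norm h * d" unfolding d_def by (rule norm_cauchy_schwarz)
    also have "\<dots> \<le> B * d" using hB by (intro mult_right_mono) (auto simp: d_def)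
    \<comment> \<open>Young's inequality with the weight \<open>\<rho> * \<tau>\<^sup>2\<close>,
      where \<open>\<tau>\<close> is still free.\<close>
    also have "\<dots> \<le> B * (d\<^sup>2 / (2 * (\<rho> * \<tau>\<^sup>2)) + \<rho> * \<tau>\<^sup>2 / 2)"
    proof (intro mult_left_mono)
      define m where "m = \<rho> * \<tau>\<^sup>2"
      have m: "m > 0" using \<rho> \<tau> by (simp add: m_def)
      have "d\<^sup>2 / (2 * m) + m / 2 - d = (d - m)\<^sup>2 / (2 * m)"
        using m by (simp add: field_simps power2_eq_square)
      also have "\<dots> \<ge> 0" using m by simp
      finally show "d \<le> d\<^sup>2 / (2 * (\<rho> * \<tau>\<^sup>2)) + \<rho> * \<tau>\<^sup>2 / 2" by (simp add: m_def)
    qed (use B in simp)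
    finally show ?thesis by (simp add: d_def algebra_simps)
  qed
  then show ?case by auto
next
  case (Suc j)
  define k where "k = N - j"
  have k: "k \<in> {1..N}" "N + 1 - j = k + 1" "N + 1 - Suc j = k" using Suc.prems by (auto simp: k_def)
  define b where "b = (add_inverse ^^ j) \<tau>"
  have b: "b \<ge> 1" using funpow_add_inverse_ge[OF \<tau>, of j] \<tau> by (simp add: b_def)
  obtain a where a: "b \<le> a" and bound: "\<And>z. z \<in> X \<Longrightarrow> f (x (N + 1)) - f z
      \<le> B / (2 * \<rho> * a\<^sup>2) * (norm (x (k + 1) - z))\<^sup>2 + B * \<rho> / 2 * (b\<^sup>2 - 2 * real j)"
    using Suc unfolding k(2) b_def by auto
  have xk: "x k \<in> X" using x k by auto
  have "norm (g k) \<le> B" using bounded xk step[OF k(1)] by (auto simp: bounded_subgradients_def)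
  then have "\<exists>a'\<ge>add_inverse b. \<forall>z\<in>X. f (x (N + 1)) - f z
      \<le> B / (2 * \<rho> * a'\<^sup>2) * (norm (x k - z))\<^sup>2
        + B * \<rho> / 2 * (b\<^sup>2 - 2 * real j) + B * \<rho> / (2 * b\<^sup>2)"
    using projected_subgradient_pullback[OF X f xk _ _ _ \<rho> _ b a bound] step[OF k(1)] by blast
  moreover have "B * \<rho> / 2 * (b\<^sup>2 - 2 * real j) + B * \<rho> / (2 * b\<^sup>2)
      = B * \<rho> / 2 * ((add_inverse b)\<^sup>2 - 2 * real (Suc j))"
    using b by (simp add: add_inverse_power2 field_simps)
  ultimately show ?case
    by (simp only: k(3) b_def add.assoc funpow.simps o_apply)
qed

theorem theorem4p1:
  fixes N :: nat and B R t :: real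
    and X D :: "(real ^ 'n) set" and f :: "real ^ 'n \<Rightarrow> real"
    and xstar :: "real ^ 'n" and x g :: "nat \<Rightarrow> real ^ 'n"
  assumes "N \<ge> 1" and "B > 0" and "R > 0"
    and "X \<noteq> {}" and "closed X" and "convex X"
    and "convex_on D f" and "X \<subseteq> D"
    and "\<forall>y\<in>X. subdifferential D f y \<noteq> {}"
    and "bounded_subgradients B D f X"
    and "is_arg_min f (\<lambda>y. y \<in> X) xstar"
    and "x 1 \<in> X" and "norm (x 1 - xstar) \<le> R"
    and "t > 0"
    and "\<forall>k\<in>{1..N}. g k \<in> subdifferential D f (x k) \<and> g k \<noteq> 0 \<and>
           x (k + 1) = closest_point X (x k - (t * (R / norm (g k))) *\<^sub>R g k)"
  shows "(t \<in> {0<..1 / (s_seq (N + 1))\<^sup>2} \<longrightarrow>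
            f (x (N + 1)) - f xstar \<le> B * R * (1 - real N * t)) \<and>
         (t \<in> {1 / (s_seq (N + 1))\<^sup>2..} \<longrightarrow>
            f (x (N + 1)) - f xstar
              \<le> B * R * ((1 / 2 * (s_seq (N + 1))\<^sup>2 - real N) * t
                          + 1 / (2 * (s_seq (N + 1))\<^sup>2 * t)))"
proof -
  have x_in: "x k \<in> X" if "k \<in> {1..N + 1}" for k
  proof (cases "k = 1")
    case False
    then have "k - 1 \<in> {1..N}" "k = k - 1 + 1" using that by auto
    then show ?thesis
      using assms(15) closest_point_in_set[OF \<open>closed X\<close> \<open>X \<noteq> {}\<close>] by metis
  qed (use \<open>x 1 \<in> X\<close> in simp)
  have xstar: "xstar \<in> X" using assms(11) by (simp add: is_arg_min_def)
  \<comment> \<open>The case \<open>j = N\<close>, \<open>\<rho> = t * R\<close>,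
    \<open>z = xstar\<close>, with \<open>a\<close> weakened to \<open>b\<close> and the initial
    distance to \<open>R\<close>.\<close>
  have main: "f (x (N + 1)) - f xstar \<le> B * R * (1 / (2 * t * b\<^sup>2) + t * b\<^sup>2 / 2 - real N * t)"
    if b: "b \<ge> s_seq (N + 1)" for b
  proof -
    obtain \<tau> where \<tau>: "\<tau> \<ge> 1" "(add_inverse ^^ N) \<tau> = b"
      using funpow_add_inverse_surj[of N b] b by auto
    have b1: "b \<ge> 1" using funpow_add_inverse_ge[OF \<tau>(1), of N] \<tau> by simp
    have "\<exists>a\<ge>b. \<forall>z\<in>X. f (x (N + 1)) - f z
        \<le> B / (2 * (t * R) * a\<^sup>2) * (norm (x 1 - z))\<^sup>2 + B * (t * R) / 2 * (b\<^sup>2 - 2 * real N)"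
      using projected_subgradient_last_iterate[of B "t * R" X D f N x g \<tau> N] assms x_in \<tau> by auto
    then obtain a where a: "a \<ge> b" and "f (x (N + 1)) - f xstar
        \<le> B / (2 * (t * R) * a\<^sup>2) * (norm (x 1 - xstar))\<^sup>2 + B * (t * R) / 2 * (b\<^sup>2 - 2 * real N)"
      using xstar by blast
    moreover have "B / (2 * (t * R) * a\<^sup>2) * (norm (x 1 - xstar))\<^sup>2 \<le> B / (2 * (t * R) * b\<^sup>2) * R\<^sup>2"
      using a b1 assms(2,3,13,14)
      by (intro mult_mono divide_left_mono mult_left_mono power_mono) auto
    moreover have "B / (2 * (t * R) * b\<^sup>2) * R\<^sup>2 + B * (t * R) / 2 * (b\<^sup>2 - 2 * real N)
        = B * R * (1 / (2 * t * b\<^sup>2) + t * b\<^sup>2 / 2 - real N * t)"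
      using b1 assms(3,14) by (simp add: field_simps power2_eq_square)
    ultimately show ?thesis by linarith
  qed
  have s1: "s_seq (N + 1) \<ge> 1" using funpow_add_inverse_ge[of 1 N] by (simp add: s_seq_eq_funpow)
  show ?thesis
  proof (intro conjI impI)
    assume "t \<in> {0<..1 / (s_seq (N + 1))\<^sup>2}"
    then have "(s_seq (N + 1))\<^sup>2 \<le> 1 / t" using s1 \<open>t > 0\<close> by (simp add: field_simps)
    \<comment> \<open>The choice \<open>b = sqrt (1 / t)\<close> minimizes the bound in
      \<open>main\<close> over positive \<open>b\<close>: both terms containing \<open>b\<close>
      become \<open>1 / 2\<close>.\<close>
    then have "s_seq (N + 1) \<le> sqrt (1 / t)" by (rule real_le_rsqrt)
    from main[OF this] show "f (x (N + 1)) - f xstar \<le> B * R * (1 - real N * t)"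
      using \<open>t > 0\<close> by simp
  next
    show "f (x (N + 1)) - f xstar
              \<le> B * R * ((1 / 2 * (s_seq (N + 1))\<^sup>2 - real N) * t
                          + 1 / (2 * (s_seq (N + 1))\<^sup>2 * t))"
      using main[OF order_refl] by (simp add: algebra_simps)
  qed
qed

end
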